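(* There exists a constant $c>0$ such that the following holds. Let $\Omega \subset \mathbb{R}^2$ be an open set with finite measure and let $u \in C^2(\Omega)\cap C(\overline{\Omega})$. Then $$ \max_{x \in \Omega} |u(x)| \leq \max_{x \in \partial \Omega}|u(x)| + c \max_{x \in \Omega} \int_{y \in \Omega} \max\left\{ 1, \log\left(\frac{|\Omega|}{\|x-y\|^2}\right) \right\} \left| \Delta u(y)\right| dy .$$
   Context: $|\Omega|$ denotes the two-dimensional Lebesgue measure of $\Omega$, $\|\cdot\|$ is the Euclidean norm on $\mathbb{R}^2$, $\Delta = \partial_1^2+\partial_2^2$ is the Laplacian, and $dy$ is Lebesgue measure. The set $\Omega$ need not be bounded; it suffices that it has finite measure. The constant $c$ does not depend on $\Omega$ or on $u$.
   Formalization: The formal theorem additionally assumes that u is bounded on Ω (automatic if Ω is bounded); for unbounded Ω of finite measure the claim otherwise fails, e.g. u = Re sinh(z³) on {|arg z| < π/6, |Im z³| < π/2}. Maxima are read as suprema. *)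

theory Defs
  imports "HOL-Analysis.Analysis"
begin

definition partial_deriv :: "'n::finite \<Rightarrow> (real^'n \<Rightarrow> real) \<Rightarrow> real^'n \<Rightarrow> real" where
  "partial_deriv i f x = deriv (\<lambda>t. f (x + t *\<^sub>R axis i 1)) 0"

(* Intended for open S only: then the values of f outside S do not matter. *)
primrec Ck_on :: "nat \<Rightarrow> (real^'n::finite) set \<Rightarrow> (real^'n \<Rightarrow> real) \<Rightarrow> bool" where
  "Ck_on 0 S f \<longleftrightarrow> continuous_on S f"
| "Ck_on (Suc k) S f \<longleftrightarrow> continuous_on S f \<and>
     (\<forall>i. (\<forall>x\<in>S. (\<lambda>t. f (x + t *\<^sub>R axis i 1)) field_differentiable at 0) \<and>
          Ck_on k S (partial_deriv i f))"

definition laplacian :: "(real^'n::finite \<Rightarrow> real) \<Rightarrow> real^'n \<Rightarrow> real" where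
  "laplacian f x = (\<Sum>i\<in>UNIV. partial_deriv i (partial_deriv i f) x)"

(* At y = x, where the logarithm is infinite, totalized division and ln give the value 1;
   this does not affect integrals over y. *)
definition log_kernel :: "(real^2) set \<Rightarrow> real^2 \<Rightarrow> real^2 \<Rightarrow> real" where
  "log_kernel \<Omega> x y = max 1 (ln (measure lborel \<Omega> / (norm (x - y))\<^sup>2))"

end

theory Submission
  imports Defs
begin

text \<open>
  Let \<open>b\<close> exceed \<open>\<bar>u\<bar>\<close> on the boundary, let \<open>A\<close> be the supremum of \<open>u - b\<close>, assumed positive, and
  consider the excess \<open>max 0 (u - b)\<close>. It vanishes near the boundary, so its cube \<open>w\<close>, extended by
  zero, is \<open>C\<^sup>2\<close> on the whole plane, and convexity of the cube gives
  \<open>\<Delta> w \<ge> 3 (max 0 (u - b))\<^sup>2 \<Delta> u \<ge> - 3 A\<^sup>2 \<bar>\<Delta> u\<bar>\<close>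
  (\<open>cubed_excess_C2\<close>).

  At a point \<open>x\<close> where the excess is nearly \<open>A\<close>, the function \<open>w\<close> is tested against a compactly
  supported \<open>\<eta>\<close> that resembles \<open>ln (L / \<parallel>x - y\<parallel>\<^sup>2)\<close> on the disc of radius \<open>sqrt L\<close>, smoothed at a scale
  \<open>\<epsilon>\<close> (\<open>logarithmic_test_function\<close>). Its Laplacian has a large negative part concentrated near
  \<open>x\<close>, an approximate point mass, and elsewhere it is at most \<open>8 / L\<close>. Integration by parts
  (\<open>integral_by_parts_second\<close>) gives \<open>\<integral> w \<Delta>\<eta> = \<integral> \<eta> \<Delta>w\<close>. In the left-hand integral the negative part
  contributes at most \<open>- A\<^sup>3 \<pi> / 2\<close>, while the rest contributes at most
  \<open>A\<^sup>3 (8 / L) \<bar>\<Omega>\<bar>\<close>, because \<open>w \<le> A\<^sup>3\<close> lives on \<open>\<Omega>\<close>. With \<open>L = 8 \<bar>\<Omega>\<bar>\<close> the second term is \<open>A\<^sup>3\<close>,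
  which the first one outweighs: a disc much larger in area than \<open>\<Omega>\<close> lies mostly where \<open>w\<close> is zero,
  so the mean of \<open>w\<close> over it stays well below \<open>A\<^sup>3\<close>. The right-hand integral is at least
  \<open>- 3 A\<^sup>2 \<integral> \<eta> \<bar>\<Delta> u\<bar>\<close>, and \<open>\<eta>\<close> is bounded by a multiple of the kernel. Dividing by \<open>A\<^sup>2\<close> bounds \<open>A\<close>
  (\<open>near_maximum_log_potential\<close>). The theorem follows by applying this to \<open>u\<close> and \<open>- u\<close> and
  letting \<open>b\<close> decrease to the boundary supremum.
\<close>

section \<open>Integration by parts along a direction\<close>

text \<open>
  A function and its derivative may be truncated simultaneously where both vanish on the
  interface: the quotients of the truncated function are dominated by those of the original one.
  This yields the derivatives both of the truncated logarithm and of powers of a positive part.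
\<close>

lemma has_real_derivative_extend_zero:
  fixes f :: "real \<Rightarrow> real"
  assumes "x \<in> closure A \<Longrightarrow> (f has_real_derivative d) (at x)"
    and "x \<in> frontier A \<Longrightarrow> f x = 0 \<and> d = 0"
  shows "((\<lambda>t. if t \<in> A then f t else 0) has_real_derivative (if x \<in> A then d else 0)) (at x)"
proof -
  consider "x \<in> interior A" | "x \<in> frontier A" | "x \<notin> closure A"
    by (auto simp: frontier_def)
  then show ?thesis
  proof cases
    case 1
    then have "x \<in> A" "x \<in> closure A"
      using interior_subset closure_subset by blast+
    moreover have "\<forall>\<^sub>F t in nhds x. (if t \<in> A then f t else 0) = f t"
      using 1 by (auto simp: eventually_nhds interior_def)
    ultimately show ?thesis
      using assms(1) DERIV_cong_ev[OF refl _ refl, of "\<lambda>t. if t \<in> A then f t else 0" f x d] by simp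
  next
    case 3
    then have "x \<notin> A"
      using closure_subset by blast
    moreover have "\<forall>\<^sub>F t in nhds x. (if t \<in> A then f t else 0) = 0"
      unfolding eventually_nhds using 3 closure_subset
      by (intro exI[of _ "- closure A"]) auto
    ultimately show ?thesis
      using DERIV_cong_ev[OF refl _ refl, of "\<lambda>t. if t \<in> A then f t else 0" "\<lambda>t. 0" x 0] by auto
  next
    case 2
    then have f: "(f has_real_derivative 0) (at x)" "f x = 0" "d = 0"
      using assms by (auto simp: frontier_def)
    have lim: "((\<lambda>h. f (x + h) / h) \<longlongrightarrow> 0) (at 0)"
      using f by (simp add: DERIV_def)
    have "((\<lambda>h. (if x + h \<in> A then f (x + h) else 0) / h) \<longlongrightarrow> 0) (at 0)"
      by (rule Lim_null_comparison[OF _ tendsto_norm_zero[OF lim]]) (auto simp: eventually_at_filter)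
    moreover have "(if x \<in> A then f x else 0) = 0"
      using f by simp
    ultimately show ?thesis
      using f unfolding DERIV_def by simp
  qed
qed

lemma integrable_continuous_bounded_support:
  fixes f :: "'a::euclidean_space \<Rightarrow> real"
  assumes "continuous_on UNIV f" "\<And>x. r \<le> dist a x \<Longrightarrow> f x = 0"
  shows "integrable lborel f"
proof -
  have "integrable lborel (\<lambda>x. indicator (cball a r) x *\<^sub>R f x)"
    using assms by (intro borel_integrable_compact) (auto intro: continuous_on_subset)
  moreover have "(\<lambda>x. indicator (cball a r) x *\<^sub>R f x) = f"
    using assms(2) by (fastforce simp: indicator_def)
  ultimately show ?thesis by simp
qed

text \<open>
  By translation invariance of Lebesgue measure the difference quotients of \<open>F\<close> in direction \<open>e\<close>
  have integral zero; they are uniformly bounded with bounded support, so dominated convergence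
  passes this to the derivative. This replaces the divergence theorem and avoids Fubini.
\<close>

lemma integral_directional_derivative_eq_0:
  fixes F D :: "'a::euclidean_space \<Rightarrow> real"
  assumes der: "\<And>x. ((\<lambda>t. F (x + t *\<^sub>R e)) has_real_derivative D x) (at 0)"
    and F: "continuous_on UNIV F" and D: "continuous_on UNIV D"
    and supp: "\<And>x. r \<le> dist a x \<Longrightarrow> F x = 0"
  shows "(\<integral>x. D x \<partial>lborel) = 0"
proof -
  define h :: "nat \<Rightarrow> real" where "h n = 1 / Suc n" for n
  have h: "0 < h n" "h n \<le> 1" for n by (auto simp: h_def)
  have h0: "h \<longlonglongrightarrow> 0" unfolding h_def by (rule LIMSEQ_Suc[OF lim_1_over_n])
  define q where "q n x = (F (x + h n *\<^sub>R e) - F x) / h n" for n x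
  obtain C where C: "\<And>x. x \<in> cball a (r + 2 * norm e) \<Longrightarrow> \<bar>D x\<bar> \<le> C"
  proof -
    have "bounded (D ` cball a (r + 2 * norm e))"
      using D by (intro compact_imp_bounded compact_continuous_image) (auto intro: continuous_on_subset)
    then obtain B where B: "\<forall>y\<in>D ` cball a (r + 2 * norm e). norm y \<le> B"
      by (auto simp only: bounded_iff)
    have "\<bar>D x\<bar> \<le> B" if "x \<in> cball a (r + 2 * norm e)" for x
      using bspec[OF B imageI[OF that]] by simp
    then show ?thesis by (rule that)
  qed
  have line: "((\<lambda>t. F (x + t *\<^sub>R e)) has_real_derivative D (x + s *\<^sub>R e)) (at s)" for x s
    using DERIV_shift[of "\<lambda>t. F (x + t *\<^sub>R e)" "D (x + s *\<^sub>R e)" 0 s] der[of "x + s *\<^sub>R e"]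
    by (simp add: algebra_simps)
  have bound: "\<bar>q n x\<bar> \<le> indicator (cball a (r + norm e)) x * C" for n x
  proof (cases "x \<in> cball a (r + norm e)")
    case False
    have "dist a x \<le> dist a (x + h n *\<^sub>R e) + norm (h n *\<^sub>R e)"
      using dist_triangle[of a x "x + h n *\<^sub>R e"] by (simp add: dist_norm)
    also have "norm (h n *\<^sub>R e) \<le> norm e"
      using h[of n] by (simp add: mult_left_le_one_le)
    finally have "r \<le> dist a (x + h n *\<^sub>R e)" "r \<le> dist a x"
      using False norm_ge_zero[of e] by (simp_all only: mem_cball, linarith+)
    then show ?thesis using False supp by (simp add: q_def)
  next
    case True
    obtain s where s: "0 < s" "s < h n"
      "F (x + h n *\<^sub>R e) - F (x + 0 *\<^sub>R e) = (h n - 0) * D (x + s *\<^sub>R e)"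
      using MVT2[of 0 "h n" "\<lambda>t. F (x + t *\<^sub>R e)" "\<lambda>s. D (x + s *\<^sub>R e)"] h[of n] line by blast
    have "dist a (x + s *\<^sub>R e) \<le> dist a x + norm (s *\<^sub>R e)"
      using dist_triangle[of a "x + s *\<^sub>R e" x] by (simp add: dist_norm)
    also have "norm (s *\<^sub>R e) \<le> norm e"
      using h[of n] s by (simp add: mult_left_le_one_le)
    finally have "x + s *\<^sub>R e \<in> cball a (r + 2 * norm e)"
      using True by simp
    moreover have "q n x = D (x + s *\<^sub>R e)"
      using s h[of n] by (simp add: q_def field_simps)
    ultimately show ?thesis using C True by simp
  qed
  have intF: "integrable lborel F"
    using F supp by (rule integrable_continuous_bounded_support)
  have [measurable]: "F \<in> borel_measurable borel" and [measurable]: "D \<in> borel_measurable borel"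
    using F D by (auto intro: borel_measurable_continuous_onI)
  have trans: "lborel = distr lborel borel (\<lambda>x. x + c)" for c :: 'a
  proof -
    have "(\<lambda>x. x + c) = (+) c" by (simp add: fun_eq_iff add.commute)
    then show ?thesis using lborel_distr_plus[of c] by simp
  qed
  have q0: "(\<integral>x. q n x \<partial>lborel) = 0" for n
  proof -
    have "integrable lborel (\<lambda>x. F (x + h n *\<^sub>R e))"
      using intF by (subst (asm) trans[of "h n *\<^sub>R e"]) (simp add: integrable_distr_eq)
    moreover have "(\<integral>x. F (x + h n *\<^sub>R e) \<partial>lborel) = (\<integral>x. F x \<partial>lborel)"
      by (subst (2) trans[of "h n *\<^sub>R e"]) (simp add: integral_distr)
    ultimately show ?thesis
      using intF by (simp add: q_def)
  qed
  have "(\<lambda>n. \<integral>x. q n x \<partial>lborel) \<longlonglongrightarrow> (\<integral>x. D x \<partial>lborel)"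
  proof (rule integral_dominated_convergence)
    show "integrable lborel (\<lambda>x. indicator (cball a (r + norm e)) x * C)"
      using borel_integrable_compact[of "cball a (r + norm e)" "\<lambda>x. C"] by simp
    show "AE x in lborel. (\<lambda>n. q n x) \<longlonglongrightarrow> D x"
    proof (rule AE_I2)
      fix x
      have "filterlim h (at 0) sequentially"
        using h0 h by (auto simp: filterlim_at intro!: always_eventually) (metis less_irrefl)
      moreover have "((\<lambda>t. (F (x + t *\<^sub>R e) - F x) / t) \<longlongrightarrow> D x) (at 0)"
        using der[of x] by (simp add: DERIV_def)
      ultimately show "(\<lambda>n. q n x) \<longlonglongrightarrow> D x"
        unfolding q_def by (rule filterlim_compose[rotated])
    qed
    show "AE x in lborel. norm (q n x) \<le> indicator (cball a (r + norm e)) x * C" for n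
      using bound by simp
  qed (auto simp: q_def)
  then show ?thesis
    using q0 LIMSEQ_unique[OF tendsto_const] by fastforce
qed

text \<open>
  The function \<open>w v2 - v w2\<close> is the derivative of \<open>w v1 - v w1\<close>, which vanishes outside a ball
  because \<open>v\<close> and \<open>v1\<close> do; so its integral is zero.
\<close>

lemma integral_by_parts_second:
  fixes v v1 v2 w w1 w2 :: "'a::euclidean_space \<Rightarrow> real"
  assumes v: "\<And>x. ((\<lambda>t. v (x + t *\<^sub>R e)) has_real_derivative v1 x) (at 0)"
    and v1: "\<And>x. ((\<lambda>t. v1 (x + t *\<^sub>R e)) has_real_derivative v2 x) (at 0)"
    and w: "\<And>x. ((\<lambda>t. w (x + t *\<^sub>R e)) has_real_derivative w1 x) (at 0)"
    and w1: "\<And>x. ((\<lambda>t. w1 (x + t *\<^sub>R e)) has_real_derivative w2 x) (at 0)"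
    and cont: "continuous_on UNIV v" "continuous_on UNIV v1" "continuous_on UNIV v2"
      "continuous_on UNIV w" "continuous_on UNIV w1" "continuous_on UNIV w2"
    and supp: "\<And>x. r \<le> dist a x \<Longrightarrow> v x = 0 \<and> v1 x = 0 \<and> v2 x = 0"
  shows "(\<integral>x. w x * v2 x \<partial>lborel) = (\<integral>x. v x * w2 x \<partial>lborel)"
proof -
  have "(\<integral>x. w x * v2 x - v x * w2 x \<partial>lborel) = 0"
  proof (rule integral_directional_derivative_eq_0[where F = "\<lambda>x. w x * v1 x - v x * w1 x" and r = r and a = a])
    fix x
    show "((\<lambda>t. w (x + t *\<^sub>R e) * v1 (x + t *\<^sub>R e) - v (x + t *\<^sub>R e) * w1 (x + t *\<^sub>R e))
      has_real_derivative w x * v2 x - v x * w2 x) (at 0)"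
      using DERIV_diff[OF DERIV_mult[OF w[of x] v1[of x]] DERIV_mult[OF v[of x] w1[of x]]]
      by (simp add: algebra_simps)
  qed (use supp cont in \<open>auto intro!: continuous_intros\<close>)
  moreover have "integrable lborel (\<lambda>x. w x * v2 x)" "integrable lborel (\<lambda>x. v x * w2 x)"
    using supp cont
    by (auto intro!: integrable_continuous_bounded_support[where r = r and a = a] continuous_intros)
  ultimately show ?thesis by simp
qed

section \<open>The truncated logarithm as a test function\<close>

text \<open>
  Subtracting from \<open>- ln\<close> its second Taylor polynomial at \<open>1\<close> makes the function vanish there to
  third order, so that the truncation at \<open>1\<close> is still \<open>C\<^sup>2\<close>. The next two functions are its
  derivatives; writing them with \<open>max\<close> makes their continuity evident.
\<close>

definition truncated_log :: "real \<Rightarrow> real" where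
  "truncated_log z = (if z \<in> {..<1} then - ln z - (1 - z) - (1 - z)\<^sup>2 / 2 else 0)"

definition truncated_log' :: "real \<Rightarrow> real" where
  "truncated_log' z = - (max 0 (1 - z))\<^sup>2 / z"

definition truncated_log'' :: "real \<Rightarrow> real" where
  "truncated_log'' z = max 0 (1 / z\<^sup>2 - 1)"

lemma DERIV_truncated_log:
  assumes "0 < z"
  shows "(truncated_log has_real_derivative truncated_log' z) (at z)"
proof -
  have "((\<lambda>z. - ln z - (1 - z) - (1 - z)\<^sup>2 / 2) has_real_derivative (- (1 - z)\<^sup>2 / z)) (at z)"
    using assms
    by (auto intro!: derivative_eq_intros simp: power2_eq_square field_simps)
  then have "((\<lambda>z. if z \<in> {..<1} then - ln z - (1 - z) - (1 - z)\<^sup>2 / 2 else 0) has_real_derivative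
      (if z \<in> {..<1} then - (1 - z)\<^sup>2 / z else 0)) (at z)"
    by (rule has_real_derivative_extend_zero) simp
  also have "(if z \<in> {..<1} then - (1 - z)\<^sup>2 / z else 0) = truncated_log' z"
    by (simp add: truncated_log'_def)
  finally show ?thesis
    unfolding truncated_log_def[abs_def] .
qed

lemma DERIV_truncated_log':
  assumes "0 < z"
  shows "(truncated_log' has_real_derivative truncated_log'' z) (at z)"
proof -
  have "((\<lambda>z. - (1 - z)\<^sup>2 / z) has_real_derivative (1 / z\<^sup>2 - 1)) (at z)"
    using assms
    by (auto intro!: derivative_eq_intros simp: power2_eq_square field_simps)
  then have "((\<lambda>z. if z \<in> {..<1} then - (1 - z)\<^sup>2 / z else 0) has_real_derivative
      (if z \<in> {..<1} then 1 / z\<^sup>2 - 1 else 0)) (at z)"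
    by (rule has_real_derivative_extend_zero) simp
  also have "(\<lambda>z. if z \<in> {..<1} then - (1 - z)\<^sup>2 / z else 0) = truncated_log'"
    by (auto simp: truncated_log'_def fun_eq_iff)
  also have "(if z \<in> {..<1} then 1 / z\<^sup>2 - 1 else 0) = truncated_log'' z"
  proof (cases "z < 1")
    case True
    then have "z\<^sup>2 \<le> 1" using assms by (simp add: power_le_one)
    then show ?thesis using True assms by (simp add: truncated_log''_def field_simps)
  next
    case False
    then have "1 \<le> z\<^sup>2" by simp
    then show ?thesis using False assms by (simp add: truncated_log''_def field_simps)
  qed
  finally show ?thesis .
qed

lemma truncated_log_nonneg:
  assumes "0 < z"
  shows "0 \<le> truncated_log z"
proof (cases "z < 1")
  case True
  have "truncated_log 1 \<le> truncated_log z"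
  proof (rule DERIV_nonpos_imp_nonincreasing[where f = truncated_log])
    show "z \<le> 1" using True by simp
    fix x assume "z \<le> x" "x \<le> 1"
    then show "\<exists>y. (truncated_log has_real_derivative y) (at x) \<and> y \<le> 0"
      using assms by (intro exI[of _ "truncated_log' x"] conjI DERIV_truncated_log)
        (auto simp: truncated_log'_def)
  qed
  then show ?thesis by (simp add: truncated_log_def)
qed (simp add: truncated_log_def)

text \<open>
  The function \<open>\<eta>\<close> is the truncated logarithm of \<open>q = (\<parallel>x - y\<parallel>\<^sup>2 + \<epsilon>) / L\<close>. In the plane the Laplacian
  of the logarithmic term is \<open>- 4 \<epsilon> / (\<parallel>x - y\<parallel>\<^sup>2 + \<epsilon>)\<^sup>2\<close>, an approximate point mass at \<open>x\<close>; it is at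
  most \<open>- 1 / \<epsilon>\<close> on the disc \<open>\<parallel>x - y\<parallel>\<^sup>2 < \<epsilon>\<close>. The Taylor polynomial contributes at most \<open>8 / L\<close>.
\<close>

lemma logarithmic_test_function:
  fixes x :: "real^2"
  assumes \<epsilon>: "0 < \<epsilon>" and L: "0 < L"
  obtains \<eta> :: "real^2 \<Rightarrow> real" and \<eta>1 \<eta>2 :: "2 \<Rightarrow> real^2 \<Rightarrow> real" where
    "\<And>i y. ((\<lambda>t. \<eta> (y + t *\<^sub>R axis i 1)) has_real_derivative \<eta>1 i y) (at 0)"
    "\<And>i y. ((\<lambda>t. \<eta>1 i (y + t *\<^sub>R axis i 1)) has_real_derivative \<eta>2 i y) (at 0)"
    "continuous_on UNIV \<eta>" "\<And>i. continuous_on UNIV (\<eta>1 i)" "\<And>i. continuous_on UNIV (\<eta>2 i)"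
    "\<And>i y. sqrt L \<le> dist x y \<Longrightarrow> \<eta> y = 0 \<and> \<eta>1 i y = 0 \<and> \<eta>2 i y = 0"
    "\<And>y. 0 \<le> \<eta> y"
    "\<And>y. y \<noteq> x \<Longrightarrow> \<eta> y \<le> max 0 (ln (L / (norm (x - y))\<^sup>2))"
    "\<And>y. (\<Sum>i\<in>UNIV. \<eta>2 i y) \<le> 8 / L"
    "\<And>y. (norm (x - y))\<^sup>2 < \<epsilon> \<Longrightarrow> (\<Sum>i\<in>UNIV. \<eta>2 i y) \<le> 8 / L - 1 / \<epsilon>"
proof -
  define z where "z y = ((norm (x - y))\<^sup>2 + \<epsilon>) / L" for y
  define z1 where "z1 i y = 2 * (y $ i - x $ i) / L" for i and y :: "real^2"
  define \<eta> where "\<eta> y = truncated_log (z y)" for y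
  define \<eta>1 where "\<eta>1 i y = truncated_log' (z y) * z1 i y" for i y
  define \<eta>2 where "\<eta>2 i y = truncated_log'' (z y) * (z1 i y)\<^sup>2 + truncated_log' (z y) * (2 / L)" for i y
  have z_pos: "0 < z y" for y
    using assms by (simp add: z_def add_nonneg_pos)
  have z1: "((\<lambda>t. z1 i (y + t *\<^sub>R axis i 1)) has_real_derivative 2 / L) (at 0)" for i y
    unfolding z1_def using L by (auto intro!: derivative_eq_intros simp: axis_def)
  have norm_sq: "(norm (x - y))\<^sup>2 = (\<Sum>i\<in>UNIV. (y $ i - x $ i)\<^sup>2)" for y
    by (simp add: norm_vec_def L2_set_def sum_nonneg power2_commute)
  have z: "((\<lambda>t. z (y + t *\<^sub>R axis i 1)) has_real_derivative z1 i y) (at 0)" for i y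
  proof -
    have "z (y + t *\<^sub>R axis i 1) = z y + t * z1 i y + t\<^sup>2 / L" for t
      using exhaust_2[of i] L unfolding z_def z1_def norm_sq
      by (auto simp: sum_2 axis_def power2_eq_square field_simps)
    then show ?thesis
      using L by (auto intro!: derivative_eq_intros)
  qed
  have z_cont: "continuous_on UNIV z" "continuous_on UNIV (z1 i)" for i
    unfolding z_def z1_def using L by (auto intro!: continuous_intros)
  have t1_cont: "continuous_on {0<..} truncated_log'" and t2_cont: "continuous_on {0<..} truncated_log''"
    unfolding truncated_log'_def[abs_def] truncated_log''_def[abs_def]
    by (auto intro!: continuous_intros)
  have t_cont: "continuous_on {0<..} truncated_log"
    by (auto intro!: DERIV_continuous_on has_field_derivative_at_within[OF DERIV_truncated_log])
  have lap: "(\<Sum>i\<in>UNIV. \<eta>2 i y) \<le> 8 / L \<and>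
      ((norm (x - y))\<^sup>2 < \<epsilon> \<longrightarrow> (\<Sum>i\<in>UNIV. \<eta>2 i y) \<le> 8 / L - 1 / \<epsilon>)" for y
  proof -
    define s where "s = (norm (x - y))\<^sup>2"
    have s: "0 \<le> s" by (simp add: s_def)
    have zy: "z y = (s + \<epsilon>) / L" by (simp add: z_def s_def)
    have "(z1 1 y)\<^sup>2 + (z1 2 y)\<^sup>2 = 4 * s / L\<^sup>2"
      unfolding z1_def s_def norm_sq by (simp only: sum_2 power_divide power_mult_distrib add_divide_distrib distrib_left) simp
    then have "(\<Sum>i\<in>UNIV. \<eta>2 i y) = truncated_log'' (z y) * (4 * s / L\<^sup>2) + truncated_log' (z y) * (4 / L)"
      unfolding \<eta>2_def sum_2 by (simp add: distrib_left[symmetric])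
    also have "\<dots> \<le> 8 / L - (if s < \<epsilon> then 1 / \<epsilon> else 0)"
    proof (cases "z y < 1")
      case True
      define q where "q = z y"
      have q: "0 < q" "q < 1" "\<epsilon> / L \<le> q"
        using True z_pos[of y] s L by (auto simp: q_def zy divide_right_mono)
      have "truncated_log'' q = 1 / q\<^sup>2 - 1"
        using q by (simp add: truncated_log''_def power_le_one field_simps)
      moreover have "truncated_log' q = - (1 - q)\<^sup>2 / q"
        using q by (simp add: truncated_log'_def)
      moreover have "4 * s / L\<^sup>2 = 4 / L * (q - \<epsilon> / L)"
        using L by (simp add: q_def zy field_simps power2_eq_square)
      moreover have "(1 / q\<^sup>2 - 1) * (k * (q - d)) + - (1 - q)\<^sup>2 / q * k
          = k * (2 - 2 * q + d) - k * (d / q\<^sup>2)" for k d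
        using q by (simp add: field_simps power2_eq_square)
      ultimately have "truncated_log'' q * (4 * s / L\<^sup>2) + truncated_log' q * (4 / L)
          = 4 / L * (2 - 2 * q + \<epsilon> / L) - 4 / L * (\<epsilon> / L / q\<^sup>2)"
        by (simp only:)
      moreover have "4 / L * (2 - 2 * q + \<epsilon> / L) \<le> 4 / L * 2"
        using q L by (intro mult_left_mono) auto
      moreover have "(if s < \<epsilon> then 1 / \<epsilon> else 0) \<le> 4 / L * (\<epsilon> / L / q\<^sup>2)"
      proof -
        have "4 / L * (\<epsilon> / L / q\<^sup>2) = 4 * \<epsilon> / (s + \<epsilon>)\<^sup>2"
          using L by (simp add: q_def zy field_simps power2_eq_square)
        moreover have "1 / \<epsilon> \<le> 4 * \<epsilon> / (s + \<epsilon>)\<^sup>2" if "s < \<epsilon>"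
        proof -
          have "(s + \<epsilon>)\<^sup>2 \<le> (2 * \<epsilon>)\<^sup>2"
            using that s by (intro power_mono) auto
          then have "4 * \<epsilon> / (2 * \<epsilon>)\<^sup>2 \<le> 4 * \<epsilon> / (s + \<epsilon>)\<^sup>2"
            using \<epsilon> s by (intro divide_left_mono) auto
          then show ?thesis
            using \<epsilon> by (simp add: power2_eq_square)
        qed
        ultimately show ?thesis using \<epsilon> by simp
      qed
      ultimately show ?thesis by (simp add: q_def)
    next
      case False
      then have "1 \<le> (z y)\<^sup>2" by simp
      then have "truncated_log'' (z y) = 0"
        by (simp add: truncated_log''_def divide_le_eq_1)
      moreover have "truncated_log' (z y) = 0"
        using False by (simp add: truncated_log'_def)
      \<comment> \<open>When \<open>\<epsilon>\<close> is comparable with \<open>L\<close>, the disc may leave the support; then \<open>L < 2 \<epsilon>\<close>.\<close>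
      moreover have "1 / \<epsilon> \<le> 8 / L" if "s < \<epsilon>"
        using that False L \<epsilon> by (simp add: zy field_simps)
      ultimately show ?thesis using L by simp
    qed
    finally show ?thesis using \<epsilon> by (auto simp: s_def split: if_splits intro: order_trans)
  qed
  show thesis
  proof (rule that[of \<eta> \<eta>1 \<eta>2])
    show "((\<lambda>t. \<eta> (y + t *\<^sub>R axis i 1)) has_real_derivative \<eta>1 i y) (at 0)" for i y
      unfolding \<eta>_def \<eta>1_def
      using DERIV_chain2[of truncated_log "truncated_log' (z y)" "\<lambda>t. z (y + t *\<^sub>R axis i 1)" 0]
        DERIV_truncated_log[OF z_pos, of y] z by simp
    show "((\<lambda>t. \<eta>1 i (y + t *\<^sub>R axis i 1)) has_real_derivative \<eta>2 i y) (at 0)" for i y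
    proof -
      have "((\<lambda>t. truncated_log' (z (y + t *\<^sub>R axis i 1))) has_real_derivative
          truncated_log'' (z y) * z1 i y) (at 0)"
        using DERIV_chain2[of truncated_log' "truncated_log'' (z y)" "\<lambda>t. z (y + t *\<^sub>R axis i 1)" 0]
          DERIV_truncated_log'[OF z_pos, of y] z by simp
      from DERIV_mult[OF this z1[of i y]] show ?thesis
        unfolding \<eta>1_def \<eta>2_def by (simp add: algebra_simps power2_eq_square)
    qed
    show "continuous_on UNIV \<eta>" "continuous_on UNIV (\<eta>1 i)" "continuous_on UNIV (\<eta>2 i)" for i
      unfolding \<eta>_def \<eta>1_def \<eta>2_def using L
      by (auto intro!: continuous_intros z_cont continuous_on_compose2[OF t_cont]
          continuous_on_compose2[OF t1_cont] continuous_on_compose2[OF t2_cont] z_pos)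
    show "\<eta> y = 0 \<and> \<eta>1 i y = 0 \<and> \<eta>2 i y = 0" if "sqrt L \<le> dist x y" for i y
    proof -
      have "(sqrt L)\<^sup>2 \<le> (norm (x - y))\<^sup>2"
        using that L by (intro power_mono) (auto simp: dist_norm)
      then have "L \<le> (norm (x - y))\<^sup>2 + \<epsilon>"
        using \<epsilon> L by simp
      then have "1 \<le> z y"
        using L by (simp add: z_def)
      moreover from this have "1 \<le> (z y)\<^sup>2" by simp
      ultimately show ?thesis
        using L by (simp add: \<eta>_def \<eta>1_def \<eta>2_def truncated_log_def truncated_log'_def truncated_log''_def
            divide_le_eq_1)
    qed
    show "0 \<le> \<eta> y" for y
      by (simp add: \<eta>_def truncated_log_nonneg z_pos)
    show "\<eta> y \<le> max 0 (ln (L / (norm (x - y))\<^sup>2))" if "y \<noteq> x" for y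
    proof (cases "z y < 1")
      case True
      have n: "0 < (norm (x - y))\<^sup>2" using that by simp
      have "\<eta> y \<le> - ln (z y)"
      proof -
        have "0 \<le> (1 - z y)\<^sup>2 / 2" by simp
        with True show ?thesis
          unfolding \<eta>_def truncated_log_def by (simp only: lessThan_iff if_True)
      qed
      also have "\<dots> = ln (1 / z y)"
        using z_pos[of y] by (simp add: ln_div)
      also have "\<dots> \<le> ln (L / (norm (x - y))\<^sup>2)"
      proof (rule ln_mono)
        show "0 < 1 / z y" using z_pos[of y] by simp
        have "L / ((norm (x - y))\<^sup>2 + \<epsilon>) \<le> L / (norm (x - y))\<^sup>2"
          using n assms by (intro divide_left_mono mult_pos_pos add_pos_pos) auto
        then show "1 / z y \<le> L / (norm (x - y))\<^sup>2"
          by (simp add: z_def)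
      qed
      finally show ?thesis by simp
    qed (simp add: \<eta>_def truncated_log_def)
    show "(\<Sum>i\<in>UNIV. \<eta>2 i y) \<le> 8 / L" for y
      using lap by blast
    show "(\<Sum>i\<in>UNIV. \<eta>2 i y) \<le> 8 / L - 1 / \<epsilon>" if "(norm (x - y))\<^sup>2 < \<epsilon>" for y
      using lap that by blast
  qed
qed

section \<open>Cubing the excess and extending it by zero\<close>

lemma DERIV_pos_part_power:
  assumes "2 \<le> n"
  shows "((\<lambda>t. (max 0 t) ^ n) has_real_derivative real n * (max 0 x) ^ (n - 1)) (at x)"
proof -
  have "((\<lambda>t. if t \<in> {0<..} then t ^ n else 0) has_real_derivative
      (if x \<in> {0<..} then real n * x ^ (n - 1) else 0)) (at x)"
    using assms by (intro has_real_derivative_extend_zero) (auto intro!: derivative_eq_intros)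
  moreover have "(\<lambda>t. if t \<in> {0<..} then t ^ n else 0) = (\<lambda>t::real. (max 0 t) ^ n)"
    using assms by (auto simp: fun_eq_iff)
  moreover have "(if x \<in> {0<..} then real n * x ^ (n - 1) else 0) = real n * (max 0 x) ^ (n - 1)"
    using assms by (auto simp: power_0_left)
  ultimately show ?thesis by simp
qed

text \<open>
  Partial derivatives are derivatives along lines, so neighbourhoods of a point have to be
  traded for neighbourhoods of the parameter \<open>0\<close>.
\<close>

lemma eventually_along_line:
  fixes y :: "'a::real_normed_vector"
  assumes "\<forall>\<^sub>F z in nhds y. P z"
  shows "\<forall>\<^sub>F t in nhds 0. P (y + t *\<^sub>R e)"
proof -
  obtain S where S: "open S" "y \<in> S" "\<And>z. z \<in> S \<Longrightarrow> P z"
    using assms by (auto simp: eventually_nhds)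
  have "open ((\<lambda>t. y + t *\<^sub>R e) -` S)"
    by (intro open_vimage S continuous_intros)
  then show ?thesis
    unfolding eventually_nhds using S by (intro exI[of _ "(\<lambda>t. y + t *\<^sub>R e) -` S"]) auto
qed

lemma continuous_on_extend_zero:
  fixes g :: "'a::real_normed_vector \<Rightarrow> real"
  assumes "open S" "continuous_on S g"
    and "\<And>y. y \<notin> S \<Longrightarrow> \<forall>\<^sub>F z in nhds y. z \<in> S \<longrightarrow> g z = 0"
  shows "continuous_on UNIV (\<lambda>y. if y \<in> S then g y else 0)"
proof -
  have "isCont (\<lambda>y. if y \<in> S then g y else 0) y" for y
  proof (cases "y \<in> S")
    case True
    have "\<forall>\<^sub>F z in nhds y. (if z \<in> S then g z else 0) = g z"
      using eventually_nhds_in_open[OF assms(1) True] by (rule eventually_mono) simp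
    then show ?thesis
      using isCont_cong[of _ g y] assms(1,2) True by (simp add: continuous_on_eq_continuous_at)
  next
    case False
    have "\<forall>\<^sub>F z in nhds y. (if z \<in> S then g z else 0) = 0"
      using assms(3)[OF False] by (rule eventually_mono) simp
    then show ?thesis
      using isCont_cong[of _ "\<lambda>z. 0" y] by simp
  qed
  then show ?thesis by (simp add: continuous_on_eq_continuous_at)
qed

lemma has_directional_derivative_extend_zero:
  fixes g d :: "'a::real_normed_vector \<Rightarrow> real"
  assumes "open S"
    and "y \<in> S \<Longrightarrow> ((\<lambda>t. g (y + t *\<^sub>R e)) has_real_derivative d y) (at 0)"
    and "y \<notin> S \<Longrightarrow> \<forall>\<^sub>F z in nhds y. z \<in> S \<longrightarrow> g z = 0"
  shows "((\<lambda>t. if y + t *\<^sub>R e \<in> S then g (y + t *\<^sub>R e) else 0) has_real_derivative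
    (if y \<in> S then d y else 0)) (at 0)"
proof (cases "y \<in> S")
  case True
  have "\<forall>\<^sub>F t in nhds 0. (if y + t *\<^sub>R e \<in> S then g (y + t *\<^sub>R e) else 0) = g (y + t *\<^sub>R e)"
    by (rule eventually_mono[OF eventually_along_line[where e = e, OF eventually_nhds_in_open[OF assms(1) True]]]) simp
  then show ?thesis
    using DERIV_cong_ev[OF refl _ refl, of _ "\<lambda>t. g (y + t *\<^sub>R e)" 0 "d y"] assms(2) True by simp
next
  case False
  have "\<forall>\<^sub>F t in nhds 0. (if y + t *\<^sub>R e \<in> S then g (y + t *\<^sub>R e) else 0) = 0"
    by (rule eventually_mono[OF eventually_along_line[where e = e, OF assms(3)[OF False]]]) simp
  then show ?thesis
    using DERIV_cong_ev[OF refl _ refl, of _ "\<lambda>t. 0" 0 0] False by simp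
qed

text \<open>
  The third power is the smallest integer power that makes the positive part \<open>C\<^sup>2\<close>. At points of
  \<open>S\<close> near the complement \<open>u < b\<close> holds, so the extension by zero creates no kink. The second
  derivative of the cube is \<open>6 p u1\<^sup>2 + 3 p\<^sup>2 u2\<close> with \<open>p = max 0 (u - b)\<close>, and dropping the nonnegative gradient term gives the
  last inequality.
\<close>

lemma cubed_excess_C2:
  fixes u :: "real^'n::finite \<Rightarrow> real"
  assumes S: "open S"
    and u: "\<And>i x. x \<in> S \<Longrightarrow> ((\<lambda>t. u (x + t *\<^sub>R axis i 1)) has_real_derivative u1 i x) (at 0)"
    and u1: "\<And>i x. x \<in> S \<Longrightarrow> ((\<lambda>t. u1 i (x + t *\<^sub>R axis i 1)) has_real_derivative u2 i x) (at 0)"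
    and cont: "continuous_on S u" "\<And>i. continuous_on S (u1 i)" "\<And>i. continuous_on S (u2 i)"
    and below: "\<And>x. x \<notin> S \<Longrightarrow> \<forall>\<^sub>F y in nhds x. y \<in> S \<longrightarrow> u y < b"
  obtains w1 w2 :: "'n \<Rightarrow> real^'n \<Rightarrow> real" where
    "continuous_on UNIV (\<lambda>y. if y \<in> S then (max 0 (u y - b)) ^ 3 else 0)"
    "\<And>i. continuous_on UNIV (w1 i)" "\<And>i. continuous_on UNIV (w2 i)"
    "\<And>i y. ((\<lambda>t. if y + t *\<^sub>R axis i 1 \<in> S then (max 0 (u (y + t *\<^sub>R axis i 1) - b)) ^ 3 else 0)
       has_real_derivative w1 i y) (at 0)"
    "\<And>i y. ((\<lambda>t. w1 i (y + t *\<^sub>R axis i 1)) has_real_derivative w2 i y) (at 0)"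
    "\<And>y. y \<notin> S \<Longrightarrow> (\<Sum>i\<in>UNIV. w2 i y) = 0"
    "\<And>y. y \<in> S \<Longrightarrow> 3 * (max 0 (u y - b))\<^sup>2 * (\<Sum>i\<in>UNIV. u2 i y) \<le> (\<Sum>i\<in>UNIV. w2 i y)"
proof -
  define p where "p y = max 0 (u y - b)" for y
  define g1 where "g1 i y = 3 * (p y)\<^sup>2 * u1 i y" for i y
  define g2 where "g2 i y = 6 * p y * (u1 i y)\<^sup>2 + 3 * (p y)\<^sup>2 * u2 i y" for i y
  have p_cont: "continuous_on S p"
    unfolding p_def by (intro continuous_intros cont)
  have below0: "\<forall>\<^sub>F z in nhds y. z \<in> S \<longrightarrow> p z = 0" if "y \<notin> S" for y
    by (rule eventually_mono[OF below[OF that]]) (auto simp: p_def)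
  have ev: "\<forall>\<^sub>F z in nhds y. z \<in> S \<longrightarrow> (p z) ^ 3 = 0" "\<forall>\<^sub>F z in nhds y. z \<in> S \<longrightarrow> g1 i z = 0"
    "\<forall>\<^sub>F z in nhds y. z \<in> S \<longrightarrow> g2 i z = 0" if "y \<notin> S" for i y
    by (rule eventually_mono[OF below0[OF that]], simp add: g1_def g2_def)+
  have pw: "((\<lambda>t. (p (y + t *\<^sub>R axis i 1)) ^ n) has_real_derivative real n * (p y) ^ (n - 1) * u1 i y) (at 0)"
    if "2 \<le> n" "y \<in> S" for n i y
  proof -
    have "((\<lambda>t. u (y + t *\<^sub>R axis i 1) - b) has_real_derivative u1 i y) (at 0)"
      using u[OF that(2), of i] by (auto intro!: derivative_eq_intros)
    from DERIV_chain2[OF DERIV_pos_part_power[OF that(1)] this]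
    show ?thesis by (simp add: p_def)
  qed
  show thesis
  proof (rule that[of "\<lambda>i y. if y \<in> S then g1 i y else 0" "\<lambda>i y. if y \<in> S then g2 i y else 0"])
    show "continuous_on UNIV (\<lambda>y. if y \<in> S then (max 0 (u y - b)) ^ 3 else 0)"
      unfolding p_def[symmetric]
      by (rule continuous_on_extend_zero[OF S _ ev(1)]) (auto intro!: continuous_intros p_cont)
    show "continuous_on UNIV (\<lambda>y. if y \<in> S then g1 i y else 0)" for i
      by (rule continuous_on_extend_zero[OF S _ ev(2)]) (auto simp: g1_def intro!: continuous_intros p_cont cont)
    show "continuous_on UNIV (\<lambda>y. if y \<in> S then g2 i y else 0)" for i
      by (rule continuous_on_extend_zero[OF S _ ev(3)]) (auto simp: g2_def intro!: continuous_intros p_cont cont)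
    show "((\<lambda>t. if y + t *\<^sub>R axis i 1 \<in> S then (max 0 (u (y + t *\<^sub>R axis i 1) - b)) ^ 3 else 0)
       has_real_derivative (if y \<in> S then g1 i y else 0)) (at 0)" for i y
      unfolding p_def[symmetric]
      using pw[of 3 y i] by (intro has_directional_derivative_extend_zero S ev(1)) (auto simp: g1_def)
    show "((\<lambda>t. if y + t *\<^sub>R axis i 1 \<in> S then g1 i (y + t *\<^sub>R axis i 1) else 0)
       has_real_derivative (if y \<in> S then g2 i y else 0)) (at 0)" for i y
    proof (intro has_directional_derivative_extend_zero S ev(2))
      assume y: "y \<in> S"
      show "((\<lambda>t. g1 i (y + t *\<^sub>R axis i 1)) has_real_derivative g2 i y) (at 0)"
        using DERIV_mult[OF DERIV_cmult[OF pw[of 2 y i], of 3] u1[OF y, of i]] y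
        unfolding g1_def g2_def by (simp add: algebra_simps power2_eq_square)
    qed
    show "3 * (max 0 (u y - b))\<^sup>2 * (\<Sum>i\<in>UNIV. u2 i y) \<le> (\<Sum>i\<in>UNIV. if y \<in> S then g2 i y else 0)"
      if "y \<in> S" for y
    proof -
      have "3 * (p y)\<^sup>2 * (\<Sum>i\<in>UNIV. u2 i y) = (\<Sum>i\<in>UNIV. 3 * (p y)\<^sup>2 * u2 i y)"
        by (simp add: sum_distrib_left)
      also have "\<dots> \<le> (\<Sum>i\<in>UNIV. g2 i y)"
        by (intro sum_mono) (simp add: g2_def p_def)
      finally show ?thesis using that by (simp add: p_def)
    qed
  qed simp
qed

section \<open>The estimate near a maximum\<close>

lemma ennreal_integral_le_nn_integral:
  assumes "integrable M f"
  shows "ennreal (\<integral>x. f x \<partial>M) \<le> (\<integral>\<^sup>+x. ennreal (f x) \<partial>M)"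
proof -
  have int: "integrable M (\<lambda>x. max 0 (f x))"
    using assms by simp
  have "ennreal (\<integral>x. f x \<partial>M) \<le> ennreal (\<integral>x. max 0 (f x) \<partial>M)"
    by (intro ennreal_leI integral_mono assms int) simp
  also have "\<dots> = (\<integral>\<^sup>+x. ennreal (max 0 (f x)) \<partial>M)"
    using int by (subst nn_integral_eq_integral) auto
  also have "\<dots> = (\<integral>\<^sup>+x. ennreal (f x) \<partial>M)"
    by (intro nn_integral_cong) (simp add: max_def ennreal_neg)
  finally show ?thesis .
qed

text \<open>
  Enlarging the area by the factor \<open>8\<close> adds only the constant \<open>ln 8\<close> to the logarithm, and the
  kernel is at least \<open>1\<close>.
\<close>

lemma ln_scaled_le_log_kernel:
  assumes "0 < measure lborel S" "y \<noteq> x"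
  shows "max 0 (ln (8 * measure lborel S / (norm (x - y))\<^sup>2)) \<le> (1 + ln 8) * log_kernel S x y"
proof -
  have n: "0 < (norm (x - y))\<^sup>2" using assms by simp
  have K: "1 \<le> log_kernel S x y" by (simp add: log_kernel_def)
  have "ln (8 * measure lborel S / (norm (x - y))\<^sup>2) = ln 8 + ln (measure lborel S / (norm (x - y))\<^sup>2)"
    using ln_mult[of 8 "measure lborel S / (norm (x - y))\<^sup>2"] n assms by simp
  also have "\<dots> \<le> ln 8 * log_kernel S x y + log_kernel S x y"
    using mult_left_mono[OF K, of "ln 8"] by (intro add_mono) (auto simp: log_kernel_def)
  finally have "ln (8 * measure lborel S / (norm (x - y))\<^sup>2) \<le> (1 + ln 8) * log_kernel S x y"
    by (simp add: algebra_simps)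
  moreover have "0 \<le> (1 + ln 8) * log_kernel S x y"
    using K by simp
  ultimately show ?thesis by simp
qed

lemma measure_ball_real2: "measure lborel (ball (x::real^2) r) = pi * r\<^sup>2" if "0 \<le> r"
  using that by (simp add: content_ball unit_ball_vol_2)

text \<open>
  Here \<open>x\<close> nearly maximizes the excess \<open>u - b\<close>. Testing its cube \<open>w\<close> against the logarithmic test
  function of squared radius \<open>L = 8 \<bar>S\<bar>\<close> gives \<open>A\<^sup>3 / 2 \<le> 3 A\<^sup>2 (1 + ln 8) I\<close>, where \<open>I\<close> is the integral
  on the right. The loss from \<open>8 / L\<close> on \<open>S\<close> is at most \<open>A\<^sup>3\<close>, the gain from the point mass is at least
  \<open>A\<^sup>3 \<pi> / 2\<close>, and \<open>\<pi> > 3\<close> leaves a gain of at least \<open>A\<^sup>3 / 2\<close>.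
\<close>

lemma near_maximum_log_potential:
  fixes S :: "(real^2) set"
  assumes S: "open S" "emeasure lborel S < \<infinity>"
    and u: "\<And>i x. x \<in> S \<Longrightarrow> ((\<lambda>t. u (x + t *\<^sub>R axis i 1)) has_real_derivative u1 i x) (at 0)"
    and u1: "\<And>i x. x \<in> S \<Longrightarrow> ((\<lambda>t. u1 i (x + t *\<^sub>R axis i 1)) has_real_derivative u2 i x) (at 0)"
    and cont: "continuous_on S u" "\<And>i. continuous_on S (u1 i)" "\<And>i. continuous_on S (u2 i)"
    and below: "\<And>x. x \<notin> S \<Longrightarrow> \<forall>\<^sub>F y in nhds x. y \<in> S \<longrightarrow> u y < b"
    and A: "0 < A" "\<And>y. y \<in> S \<Longrightarrow> u y - b \<le> A"
    and x: "x \<in> S" "9 / 10 * A < u x - b"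
  shows "ennreal A \<le> ennreal (6 * (1 + ln 8)) *
    (\<integral>\<^sup>+y\<in>S. ennreal (log_kernel S x y * \<bar>\<Sum>i\<in>UNIV. u2 i y\<bar>) \<partial>lborel)"
proof -
  define w where "w y = (if y \<in> S then (max 0 (u y - b)) ^ 3 else 0)" for y
  define f where "f y = (\<Sum>i\<in>UNIV. u2 i y)" for y
  define I where "I = (\<integral>\<^sup>+y\<in>S. ennreal (log_kernel S x y * \<bar>f y\<bar>) \<partial>lborel)"
  define L where "L = 8 * measure lborel S"
  obtain w1 w2 where w_cont: "continuous_on UNIV w"
    "\<And>i. continuous_on UNIV (w1 i)" "\<And>i. continuous_on UNIV (w2 i)"
    and w: "\<And>i y. ((\<lambda>t. w (y + t *\<^sub>R axis i 1)) has_real_derivative w1 i y) (at 0)"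
    and w1: "\<And>i y. ((\<lambda>t. w1 i (y + t *\<^sub>R axis i 1)) has_real_derivative w2 i y) (at 0)"
    and w2: "\<And>y. y \<notin> S \<Longrightarrow> (\<Sum>i\<in>UNIV. w2 i y) = 0"
      "\<And>y. y \<in> S \<Longrightarrow> 3 * (max 0 (u y - b))\<^sup>2 * f y \<le> (\<Sum>i\<in>UNIV. w2 i y)"
    unfolding w_def f_def
    by (rule cubed_excess_C2[OF S(1), of u u1 u2 b]) (use assms in blast)+
  have w_nonneg: "0 \<le> w y" for y by (simp add: w_def)
  have p_le: "max 0 (u y - b) \<le> A" if "y \<in> S" for y
    using A that by simp
  have w_le: "w y \<le> A ^ 3" for y
    using A p_le[of y] by (auto simp: w_def intro!: power_mono)
  \<comment> \<open>The factor \<open>9 / 10\<close> only has to have a cube above \<open>1 / 2\<close>.\<close>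
  have "A ^ 3 / 2 < (9 / 10 * A) ^ 3"
    using A by (simp add: power3_eq_cube)
  also have "\<dots> < w x"
    using x A by (simp add: w_def power_strict_mono)
  finally have "\<forall>\<^sub>F y in nhds x. A ^ 3 / 2 < w y"
    using w_cont(1) by (intro order_tendstoD(1)[of w "w x"])
      (simp_all add: continuous_on_eq_continuous_at isCont_def tendsto_at_iff_tendsto_nhds)
  then obtain \<delta> where \<delta>: "0 < \<delta>" "\<And>y. dist y x < \<delta> \<Longrightarrow> A ^ 3 / 2 < w y"
    unfolding eventually_nhds_metric by blast
  have S_meas: "0 < measure lborel S"
  proof -
    obtain r where r: "0 < r" "ball x r \<subseteq> S"
      using S(1) x(1) open_contains_ball by blast
    then have "measure lborel (ball x r) \<le> measure lborel S"
      using S by (intro measure_mono_fmeasurable) (auto simp: fmeasurable_def)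
    then show ?thesis
      using r by (auto simp: measure_ball_real2 intro: less_le_trans[rotated])
  qed
  then have L: "0 < L" by (simp add: L_def)
  have \<epsilon>: "0 < \<delta>\<^sup>2" using \<delta> by simp
  obtain \<eta> :: "real^2 \<Rightarrow> real" and \<eta>1 \<eta>2 :: "2 \<Rightarrow> real^2 \<Rightarrow> real" where
    \<eta>: "\<And>i y. ((\<lambda>t. \<eta> (y + t *\<^sub>R axis i 1)) has_real_derivative \<eta>1 i y) (at 0)"
    "\<And>i y. ((\<lambda>t. \<eta>1 i (y + t *\<^sub>R axis i 1)) has_real_derivative \<eta>2 i y) (at 0)"
    and \<eta>_cont: "continuous_on UNIV \<eta>" "\<And>i. continuous_on UNIV (\<eta>1 i)" "\<And>i. continuous_on UNIV (\<eta>2 i)"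
    and \<eta>_supp: "\<And>i y. sqrt L \<le> dist x y \<Longrightarrow> \<eta> y = 0 \<and> \<eta>1 i y = 0 \<and> \<eta>2 i y = 0"
    and \<eta>_nonneg: "\<And>y. 0 \<le> \<eta> y"
    and \<eta>_le: "\<And>y. y \<noteq> x \<Longrightarrow> \<eta> y \<le> max 0 (ln (L / (norm (x - y))\<^sup>2))"
    and \<eta>2: "\<And>y. (\<Sum>i\<in>UNIV. \<eta>2 i y) \<le> 8 / L"
      "\<And>y. (norm (x - y))\<^sup>2 < \<delta>\<^sup>2 \<Longrightarrow> (\<Sum>i\<in>UNIV. \<eta>2 i y) \<le> 8 / L - 1 / \<delta>\<^sup>2"
    by (rule logarithmic_test_function[OF \<epsilon> L, of x]) blast
  have int: "integrable lborel (\<lambda>y. w y * \<eta>2 i y)" "integrable lborel (\<lambda>y. \<eta> y * w2 i y)" for i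
    using \<eta>_supp w_cont \<eta>_cont
    by (auto intro!: integrable_continuous_bounded_support[where r = "sqrt L" and a = x] continuous_intros)
  have "(\<integral>y. \<eta> y * (\<Sum>i\<in>UNIV. w2 i y) \<partial>lborel) = (\<Sum>i\<in>UNIV. \<integral>y. \<eta> y * w2 i y \<partial>lborel)"
    using int by (simp add: sum_distrib_left)
  also have "\<dots> = (\<Sum>i\<in>UNIV. \<integral>y. w y * \<eta>2 i y \<partial>lborel)"
    by (intro sum.cong refl integral_by_parts_second[symmetric, where r = "sqrt L" and a = x])
      (use \<eta> w w1 w_cont \<eta>_cont \<eta>_supp in blast)+
  also have "\<dots> = (\<integral>y. w y * (\<Sum>i\<in>UNIV. \<eta>2 i y) \<partial>lborel)"
    using int by (simp add: sum_distrib_left)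
  also have "\<dots> \<le> (\<integral>y. A ^ 3 * (8 / L) * indicator S y - A ^ 3 / (2 * \<delta>\<^sup>2) * indicator (ball x \<delta>) y \<partial>lborel)"
  proof (rule integral_mono)
    show "integrable lborel (\<lambda>y. w y * (\<Sum>i\<in>UNIV. \<eta>2 i y))"
      using int by (simp add: sum_distrib_left)
    show "integrable lborel (\<lambda>y. A ^ 3 * (8 / L) * indicator S y - A ^ 3 / (2 * \<delta>\<^sup>2) * indicator (ball x \<delta>) y)"
      using S emeasure_bounded_finite[OF bounded_ball, of x \<delta>]
      by (intro Bochner_Integration.integrable_diff integrable_mult_right integrable_real_indicator) auto
    fix y
    show "w y * (\<Sum>i\<in>UNIV. \<eta>2 i y)
      \<le> A ^ 3 * (8 / L) * indicator S y - A ^ 3 / (2 * \<delta>\<^sup>2) * indicator (ball x \<delta>) y"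
    proof (cases "y \<in> S")
      case False
      then have "w y = 0" by (simp add: w_def)
      moreover have "y \<notin> ball x \<delta>"
        using \<delta>(2)[of y] \<open>w y = 0\<close> A by (auto simp: dist_commute)
      ultimately show ?thesis using False by simp
    next
      case True
      have wL: "w y * (8 / L) \<le> A ^ 3 * (8 / L)"
        using w_le L by (intro mult_right_mono) auto
      show ?thesis
      proof (cases "y \<in> ball x \<delta>")
        case False
        have "w y * (\<Sum>i\<in>UNIV. \<eta>2 i y) \<le> w y * (8 / L)"
          by (intro mult_left_mono \<eta>2 w_nonneg)
        then show ?thesis using wL True False by simp
      next
        case y: True
        then have "(norm (x - y))\<^sup>2 < \<delta>\<^sup>2"
          by (simp add: dist_norm power_strict_mono)
        then have "w y * (\<Sum>i\<in>UNIV. \<eta>2 i y) \<le> w y * (8 / L - 1 / \<delta>\<^sup>2)"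
          by (intro mult_left_mono \<eta>2 w_nonneg)
        moreover have "A ^ 3 / 2 * (1 / \<delta>\<^sup>2) \<le> w y * (1 / \<delta>\<^sup>2)"
          using \<delta>(2)[of y] y by (intro mult_right_mono) (auto simp: dist_commute)
        ultimately show ?thesis using wL True y by (simp add: algebra_simps)
      qed
    qed
  qed
  also have "\<dots> = A ^ 3 * (8 / L) * measure lborel S - A ^ 3 / (2 * \<delta>\<^sup>2) * measure lborel (ball x \<delta>)"
    using S emeasure_bounded_finite[OF bounded_ball, of x \<delta>]
    by (subst Bochner_Integration.integral_diff) auto
  also have "\<dots> = A ^ 3 * (1 - pi / 2)"
    using \<delta> S_meas by (simp add: measure_ball_real2 L_def algebra_simps)
  also have "\<dots> \<le> A ^ 3 * (- 1 / 2)"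
    using A pi_gt3 by (intro mult_left_mono) auto
  finally have lower: "A ^ 3 / 2 \<le> (\<integral>y. - (\<eta> y * (\<Sum>i\<in>UNIV. w2 i y)) \<partial>lborel)"
    by simp
  have [measurable]: "S \<in> sets borel" using S by simp
  have "continuous_on S f"
    unfolding f_def by (intro continuous_intros cont)
  then have "(\<lambda>y. indicator S y *\<^sub>R f y) \<in> borel_measurable borel"
    using S by (intro borel_measurable_continuous_on_indicator) auto
  then have f_meas: "(\<lambda>y. ennreal (log_kernel S x y * \<bar>indicator S y *\<^sub>R f y\<bar>)) \<in> borel_measurable lborel"
    unfolding log_kernel_def by measurable
  have I_eq: "I = (\<integral>\<^sup>+y. ennreal (log_kernel S x y * \<bar>indicator S y *\<^sub>R f y\<bar>) \<partial>lborel)"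
    unfolding I_def by (intro nn_integral_cong) (auto simp: indicator_def)
  define c where "c = 3 * A\<^sup>2 * (1 + ln 8)"
  have c: "0 \<le> c" by (simp add: c_def)
  have "ennreal (A ^ 3 / 2) \<le> ennreal (\<integral>y. - (\<eta> y * (\<Sum>i\<in>UNIV. w2 i y)) \<partial>lborel)"
    using lower by (rule ennreal_leI)
  also have "\<dots> \<le> (\<integral>\<^sup>+y. ennreal (- (\<eta> y * (\<Sum>i\<in>UNIV. w2 i y))) \<partial>lborel)"
    using int by (intro ennreal_integral_le_nn_integral) (simp add: sum_distrib_left)
  also have "\<dots> \<le> (\<integral>\<^sup>+y. ennreal c * ennreal (log_kernel S x y * \<bar>indicator S y *\<^sub>R f y\<bar>) \<partial>lborel)"
  proof (rule nn_integral_mono_AE)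
    \<comment> \<open>At \<open>y = x\<close> the kernel takes the value \<open>1\<close>, which does not bound \<open>\<eta>\<close>.\<close>
    have "AE y in lborel. y \<noteq> x"
      by (rule AE_lborel_singleton)
    then show "AE y in lborel. ennreal (- (\<eta> y * (\<Sum>i\<in>UNIV. w2 i y)))
        \<le> ennreal c * ennreal (log_kernel S x y * \<bar>indicator S y *\<^sub>R f y\<bar>)"
    proof (rule AE_mp, intro AE_I2 impI)
      fix y assume y: "y \<noteq> x"
      show "ennreal (- (\<eta> y * (\<Sum>i\<in>UNIV. w2 i y)))
        \<le> ennreal c * ennreal (log_kernel S x y * \<bar>indicator S y *\<^sub>R f y\<bar>)"
      proof (cases "y \<in> S")
        case True
        have "\<eta> y \<le> (1 + ln 8) * log_kernel S x y"
          using \<eta>_le[OF y] ln_scaled_le_log_kernel[OF S_meas y] unfolding L_def by (rule order_trans)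
        moreover have "- (\<Sum>i\<in>UNIV. w2 i y) \<le> 3 * A\<^sup>2 * \<bar>f y\<bar>"
        proof -
          have "- (\<Sum>i\<in>UNIV. w2 i y) \<le> 3 * (max 0 (u y - b))\<^sup>2 * (- f y)"
            using w2(2)[OF True] by simp
          also have "\<dots> \<le> 3 * (max 0 (u y - b))\<^sup>2 * \<bar>f y\<bar>"
            by (intro mult_left_mono) auto
          also have "\<dots> \<le> 3 * A\<^sup>2 * \<bar>f y\<bar>"
            using p_le[OF True] by (intro mult_right_mono mult_left_mono power_mono) auto
          finally show ?thesis .
        qed
        ultimately have "\<eta> y * (- (\<Sum>i\<in>UNIV. w2 i y)) \<le> ((1 + ln 8) * log_kernel S x y) * (3 * A\<^sup>2 * \<bar>f y\<bar>)"
          using \<eta>_nonneg[of y] by (meson mult_left_mono mult_right_mono order_trans mult_nonneg_nonneg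
            abs_ge_zero zero_le_power2 zero_le_numeral)
        then show ?thesis
          unfolding ennreal_mult'[OF c, symmetric] using True by (intro ennreal_leI) (simp add: c_def mult_ac)
      qed (simp add: w2)
    qed
  qed
  also have "\<dots> = ennreal c * I"
    using f_meas I_eq by (simp add: nn_integral_cmult)
  finally have main: "ennreal (A ^ 3 / 2) \<le> ennreal c * I" .
  show ?thesis
    unfolding f_def[symmetric] I_def[symmetric]
  proof (cases I)
    case (real r)
    then have "ennreal (A ^ 3 / 2) \<le> ennreal (c * r)"
      using main c by (simp add: ennreal_mult)
    then have "A ^ 3 / 2 \<le> c * r"
      using c real by simp
    then have "A\<^sup>2 * A \<le> A\<^sup>2 * (6 * (1 + ln 8) * r)"
      by (simp add: c_def power2_eq_square power3_eq_cube algebra_simps)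
    then have "A \<le> 6 * (1 + ln 8) * r"
      using A by simp
    then show "ennreal A \<le> ennreal (6 * (1 + ln 8)) * I"
      unfolding real(2) by (subst ennreal_mult'[symmetric]) (auto intro!: ennreal_leI)
  next
    case top
    have "0 < 6 * (1 + ln 8 :: real)"
      by (simp add: add_pos_nonneg del: distrib_left_numeral)
    then show "ennreal A \<le> ennreal (6 * (1 + ln 8)) * I"
      using top by (simp add: ennreal_mult_top)
  qed
qed

section \<open>Passing to the supremum\<close>

text \<open>
  Boundedness of \<open>u\<close> makes the supremum \<open>A\<close> of the excess finite, so that a near maximizer exists;
  on an unbounded set it need not be attained. Continuity up to the boundary provides the
  neighbourhoods on which \<open>u\<close> stays below \<open>b\<close>.
\<close>

lemma sup_excess_le_log_potential:
  fixes S :: "(real^2) set"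
  assumes S: "open S" "emeasure lborel S < \<infinity>"
    and u: "\<And>i x. x \<in> S \<Longrightarrow> ((\<lambda>t. u (x + t *\<^sub>R axis i 1)) has_real_derivative u1 i x) (at 0)"
    and u1: "\<And>i x. x \<in> S \<Longrightarrow> ((\<lambda>t. u1 i (x + t *\<^sub>R axis i 1)) has_real_derivative u2 i x) (at 0)"
    and cont: "continuous_on S u" "\<And>i. continuous_on S (u1 i)" "\<And>i. continuous_on S (u2 i)"
    and closure: "continuous_on (closure S) u" and boundary: "\<And>x. x \<in> frontier S \<Longrightarrow> u x < b"
    and bounded: "bounded (u ` S)" and x: "x \<in> S"
  shows "ennreal (u x - b) \<le> ennreal (6 * (1 + ln 8)) *
    (SUP z\<in>S. \<integral>\<^sup>+y\<in>S. ennreal (log_kernel S z y * \<bar>\<Sum>i\<in>UNIV. u2 i y\<bar>) \<partial>lborel)"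
proof (cases "b < u x")
  case True
  define A where "A = (SUP y\<in>S. u y - b)"
  have bdd: "bdd_above ((\<lambda>y. u y - b) ` S)"
  proof -
    obtain B where "\<And>y. y \<in> S \<Longrightarrow> \<bar>u y\<bar> \<le> B"
      using bounded by (auto simp: bounded_iff)
    then show ?thesis
      by (intro bdd_aboveI2[of _ _ "B - b"]) (simp add: abs_le_iff)
  qed
  have A: "u y - b \<le> A" if "y \<in> S" for y
    unfolding A_def by (rule cSUP_upper[OF that bdd])
  then have A_pos: "0 < A" using A[OF x] True by simp
  then obtain z where z: "z \<in> S" "9 / 10 * A < u z - b"
    using less_cSUP_iff[OF _ bdd, of "9 / 10 * A"] x by (auto simp: A_def)
  have below: "\<forall>\<^sub>F y in nhds p. y \<in> S \<longrightarrow> u y < b" if "p \<notin> S" for p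
  proof (cases "p \<in> closure S")
    case True
    then have "p \<in> frontier S"
      using that S(1) by (simp add: frontier_def interior_open)
    then have "(u \<longlongrightarrow> u p) (at p within closure S)" "u p < b"
      using closure True boundary by (auto simp: continuous_on_def)
    then have "\<forall>\<^sub>F y in at p within closure S. u y < b"
      by (rule order_tendstoD(2))
    then show ?thesis
      unfolding eventually_at_filter using that closure_subset
      by (elim eventually_mono) blast
  next
    case False
    then have "\<forall>\<^sub>F y in nhds p. y \<in> - closure S"
      by (intro eventually_nhds_in_open) auto
    then show ?thesis
      using closure_subset by (elim eventually_mono) blast
  qed
  have "ennreal (u x - b) \<le> ennreal A"
    using A[OF x] by (rule ennreal_leI)
  also have "\<dots> \<le> ennreal (6 * (1 + ln 8)) *
      (\<integral>\<^sup>+y\<in>S. ennreal (log_kernel S z y * \<bar>\<Sum>i\<in>UNIV. u2 i y\<bar>) \<partial>lborel)"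
    by (rule near_maximum_log_potential[OF S u u1 cont below A_pos A z])
  also have "\<dots> \<le> ennreal (6 * (1 + ln 8)) *
      (SUP z\<in>S. \<integral>\<^sup>+y\<in>S. ennreal (log_kernel S z y * \<bar>\<Sum>i\<in>UNIV. u2 i y\<bar>) \<partial>lborel)"
    by (intro mult_left_mono SUP_upper z) simp
  finally show ?thesis .
qed (simp add: ennreal_neg)

lemma Ck_on_2D:
  assumes "Ck_on 2 S u"
  shows "x \<in> S \<Longrightarrow> ((\<lambda>t. u (x + t *\<^sub>R axis i 1)) has_real_derivative partial_deriv i u x) (at 0)"
    and "x \<in> S \<Longrightarrow> ((\<lambda>t. partial_deriv i u (x + t *\<^sub>R axis i 1)) has_real_derivative
      partial_deriv i (partial_deriv i u) x) (at 0)"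
    and "continuous_on S u" "continuous_on S (partial_deriv i u)"
      "continuous_on S (partial_deriv i (partial_deriv i u))"
proof -
  have *: "((\<lambda>t. f (x + t *\<^sub>R axis i 1)) has_real_derivative partial_deriv i f x) (at 0)"
    if "(\<lambda>t. f (x + t *\<^sub>R axis i 1)) field_differentiable at 0" for f and x :: "real^'a" and i
    using that by (simp add: partial_deriv_def DERIV_deriv_iff_field_differentiable)
  show "x \<in> S \<Longrightarrow> ((\<lambda>t. u (x + t *\<^sub>R axis i 1)) has_real_derivative partial_deriv i u x) (at 0)"
    and "x \<in> S \<Longrightarrow> ((\<lambda>t. partial_deriv i u (x + t *\<^sub>R axis i 1)) has_real_derivative
      partial_deriv i (partial_deriv i u) x) (at 0)"
    and "continuous_on S u" "continuous_on S (partial_deriv i u)"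
      "continuous_on S (partial_deriv i (partial_deriv i u))"
    using assms by (auto simp: numeral_2_eq_2 intro!: *)
qed

theorem theorem2:
  shows "\<exists>c::real. c > 0 \<and>
    (\<forall>(\<Omega> :: (real^2) set) (u :: real^2 \<Rightarrow> real).
      open \<Omega> \<longrightarrow> emeasure lborel \<Omega> < \<infinity> \<longrightarrow>
      Ck_on 2 \<Omega> u \<longrightarrow> continuous_on (closure \<Omega>) u \<longrightarrow> bounded (u ` \<Omega>) \<longrightarrow>
      (SUP x\<in>\<Omega>. ennreal \<bar>u x\<bar>)
        \<le> (SUP x\<in>frontier \<Omega>. ennreal \<bar>u x\<bar>)
          + ennreal c * (SUP x\<in>\<Omega>. \<integral>\<^sup>+y\<in>\<Omega>. ennreal (log_kernel \<Omega> x y * \<bar>laplacian u y\<bar>) \<partial>lborel))"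
proof (intro exI[of _ "6 * (1 + ln 8)"] conjI allI impI)
  show "0 < 6 * (1 + ln 8 :: real)"
    by (simp add: add_pos_nonneg del: distrib_left_numeral)
next
  fix \<Omega> :: "(real^2) set" and u :: "real^2 \<Rightarrow> real"
  assume \<Omega>: "open \<Omega>" "emeasure lborel \<Omega> < \<infinity>" and u: "Ck_on 2 \<Omega> u"
    and closure: "continuous_on (closure \<Omega>) u" and bounded: "bounded (u ` \<Omega>)"
  let ?b = "SUP x\<in>frontier \<Omega>. ennreal \<bar>u x\<bar>"
  let ?M = "ennreal (6 * (1 + ln 8)) *
    (SUP x\<in>\<Omega>. \<integral>\<^sup>+y\<in>\<Omega>. ennreal (log_kernel \<Omega> x y * \<bar>laplacian u y\<bar>) \<partial>lborel)"
  have "ennreal \<bar>u x\<bar> \<le> ?b + ?M" if x: "x \<in> \<Omega>" for x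
  proof (cases ?b)
    case (real b)
    have frontier_le: "\<bar>u y\<bar> \<le> b" if "y \<in> frontier \<Omega>" for y
    proof -
      have "ennreal \<bar>u y\<bar> \<le> ennreal b"
        unfolding real(2)[symmetric] by (rule SUP_upper[OF that])
      then show ?thesis using real(1) by simp
    qed
    \<comment> \<open>The level has to lie strictly above \<open>\<bar>u\<bar>\<close> on the boundary, hence the slack \<open>e\<close>.\<close>
    show ?thesis
    proof (rule ennreal_le_epsilon)
      fix e :: real assume e: "0 < e"
      have plus: "ennreal (u x - (b + e)) \<le> ?M"
        unfolding laplacian_def
      proof (rule sup_excess_le_log_potential[where u = u and ?u1.0 = "\<lambda>i. partial_deriv i u"
            and ?u2.0 = "\<lambda>i. partial_deriv i (partial_deriv i u)"])
        show "u y < b + e" if "y \<in> frontier \<Omega>" for y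
          using frontier_le[OF that] e by simp
      qed (use \<Omega> Ck_on_2D[OF u] closure bounded x in auto)
      have "ennreal (- u x - (b + e)) \<le> ennreal (6 * (1 + ln 8)) *
          (SUP z\<in>\<Omega>. \<integral>\<^sup>+y\<in>\<Omega>. ennreal (log_kernel \<Omega> z y *
            \<bar>\<Sum>i\<in>UNIV. - partial_deriv i (partial_deriv i u) y\<bar>) \<partial>lborel)"
      proof (rule sup_excess_le_log_potential[where u = "\<lambda>x. - u x" and ?u1.0 = "\<lambda>i x. - partial_deriv i u x"])
        show "bounded ((\<lambda>x. - u x) ` \<Omega>)"
          using bounded by (simp add: bounded_iff)
        show "- u y < b + e" if "y \<in> frontier \<Omega>" for y
          using frontier_le[OF that] e by simp
      qed (use \<Omega> Ck_on_2D[OF u] closure x in \<open>auto intro!: continuous_intros DERIV_minus\<close>)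
      then have minus: "ennreal (- u x - (b + e)) \<le> ?M"
        by (simp add: laplacian_def sum_negf)
      have "ennreal \<bar>u x\<bar> \<le> ennreal (b + e) + ennreal (\<bar>u x\<bar> - (b + e))"
        using real e by (cases "b + e \<le> \<bar>u x\<bar>") (auto simp: ennreal_plus[symmetric] ennreal_neg simp del: ennreal_plus)
      also have "\<dots> \<le> ennreal (b + e) + ?M"
        using plus minus by (intro add_left_mono) (cases "0 \<le> u x"; simp)
      finally show "ennreal \<bar>u x\<bar> \<le> ?b + ?M + ennreal e"
        using real e by (simp add: add_ac)
    qed
  next
    case top
    show ?thesis by (simp only: top) simp
  qed
  then show "(SUP x\<in>\<Omega>. ennreal \<bar>u x\<bar>) \<le> ?b + ?M"
    by (rule SUP_least)
qed

end
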